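(* Let $\theta$ be an inner function on $\mathbb{D}^2$. Then the following are equivalent: (a) The function $\theta$ is a product of two one variable inner functions, i.e. $\theta(z)=\phi(z_1)\psi(z_2)$ with $\phi,\psi$ inner functions on $\mathbb{D}$. (b) There is some pair $(K_1,K_2)$ of Agler kernels of $\theta$ such that $K_1$ is a function of only $z_2$ and $\bar w_2$ and $$\lim_{r\nearrow 1}\left(1-r^2|\tau_1|^2\right)K_2\big((r\tau_1,z_2),(r\tau_1,w_2)\big)=0$$ for every $z_2,w_2\in\mathbb{D}$ and almost every $\tau_1\in\mathbb{T}$. (c) There is some pair $(\widetilde K_1,\widetilde K_2)$ of Agler kernels of $\theta$ such that $\widetilde K_2$ is a function of only $z_1$ and $\bar w_1$ and $$\lim_{r\nearrow 1}\left(1-r^2|\tau_2|^2\right)\widetilde K_1\big((z_1,r\tau_2),(w_1,r\tau_2)\big)=0$$ for every $z_1,w_1\in\mathbb{D}$ and almost every $\tau_2\in\mathbb{T}$.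
   Context: An inner function on $\mathbb{D}^d$ ($d=1,2$) is a bounded holomorphic function whose radial boundary values are unimodular almost everywhere on $\mathbb{T}^d$ (unimodular constants are included). A pair of Agler kernels of an inner function $\theta$ on $\mathbb{D}^2$ is a pair $(K_1,K_2)$ of positive (semidefinite) kernels $K_1,K_2:\mathbb{D}^2\times\mathbb{D}^2\to\mathbb{C}$ such that $$1-\theta(z)\overline{\theta(w)} = (1-z_1\bar w_1)K_2(z,w)+(1-z_2\bar w_2)K_1(z,w)\qquad(z=(z_1,z_2),\ w=(w_1,w_2)\in\mathbb{D}^2).$$ *)

theory Defs
  imports "HOL-Analysis.Analysis"
begin

abbreviation unit_disk :: "complex set" where
  "unit_disk \<equiv> ball 0 1"

definition bidisk :: "(complex \<times> complex) set" where
  "bidisk = unit_disk \<times> unit_disk"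

text \<open>Normalised arc length on the unit circle. Its underlying space is the circle itself,
  so almost-everywhere statements range over unimodular numbers only.\<close>

definition circle_measure :: "complex measure" where
  "circle_measure =
     distr (uniform_measure lborel {0..<2*pi}) (restrict_space borel (sphere 0 1)) cis"

lemma space_circle_measure [simp]: "space circle_measure = sphere 0 1"
  by (simp add: circle_measure_def space_restrict_space)

lemma sets_circle_measure [measurable_cong]:
  "sets circle_measure = sets (restrict_space borel (sphere 0 1))"
  by (simp add: circle_measure_def)

lemma emeasure_space_circle_measure: "emeasure circle_measure (space circle_measure) = 1"
proof -
  have "cis \<in> borel_measurable borel"
    by (intro borel_measurable_continuous_onI continuous_intros)
  then have b: "cis \<in> borel_measurable (uniform_measure lborel {0..<2*pi})"
    by (simp add: measurable_def)
  have m: "cis \<in> uniform_measure lborel {0..<2*pi} \<rightarrow>\<^sub>M restrict_space borel (sphere 0 1)"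
    by (rule measurable_restrict_space2) (use b in auto)
  have v: "cis -` sphere 0 1 = UNIV"
    by auto
  have "emeasure circle_measure (space circle_measure)
      = emeasure (uniform_measure lborel {0..<2*pi}) (cis -` sphere 0 1 \<inter> UNIV)"
    unfolding space_circle_measure unfolding circle_measure_def
    by (subst emeasure_distr[OF m]) (auto simp: sets_restrict_space)
  also have "\<dots> = 1"
    unfolding v by (simp add: emeasure_uniform_measure ennreal_divide_self)
  finally show ?thesis .
qed

lemma finite_measure_circle_measure: "finite_measure circle_measure"
  by (rule finite_measureI) (simp add: emeasure_space_circle_measure del: space_circle_measure)

text \<open>Holomorphy in two variables: at every point the function has a complex-linear total
  derivative.\<close>

definition holomorphic2_on :: "(complex \<times> complex \<Rightarrow> complex) \<Rightarrow> (complex \<times> complex) set \<Rightarrow> bool"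
  (infixl "holomorphic2'_on" 50) where
  "f holomorphic2_on S \<longleftrightarrow>
     (\<forall>z\<in>S. \<exists>a b. (f has_derivative (\<lambda>h. a * fst h + b * snd h)) (at z within S))"

definition inner_disk :: "(complex \<Rightarrow> complex) \<Rightarrow> bool" where
  "inner_disk f \<longleftrightarrow>
     f holomorphic_on unit_disk \<and> bounded (f ` unit_disk) \<and>
     (AE \<tau> in circle_measure.
        \<exists>l. cmod l = 1 \<and> ((\<lambda>r. f (of_real r * \<tau>)) \<longlongrightarrow> l) (at_left 1))"

definition inner_bidisk :: "(complex \<times> complex \<Rightarrow> complex) \<Rightarrow> bool" where
  "inner_bidisk f \<longleftrightarrow>
     f holomorphic2_on bidisk \<and> bounded (f ` bidisk) \<and>
     (AE \<tau> in circle_measure \<Otimes>\<^sub>M circle_measure.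
        \<exists>l. cmod l = 1 \<and>
          ((\<lambda>r. f (of_real r * fst \<tau>, of_real r * snd \<tau>)) \<longlongrightarrow> l) (at_left 1))"

text \<open>Membership in the nonnegative reals includes that the quadratic form is real-valued.\<close>

definition positive_kernel_on :: "'a set \<Rightarrow> ('a \<Rightarrow> 'a \<Rightarrow> complex) \<Rightarrow> bool" where
  "positive_kernel_on S K \<longleftrightarrow>
     (\<forall>F c. finite F \<and> F \<subseteq> S \<longrightarrow>
        (\<Sum>z\<in>F. \<Sum>w\<in>F. c z * cnj (c w) * K z w) \<in> \<real>\<^sub>\<ge>\<^sub>0)"

text \<open>Note the crossed indices: the kernel with index 2 carries the factor in the first variable.\<close>

definition agler_kernels ::
  "(complex \<times> complex \<Rightarrow> complex) \<Rightarrow>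
   (complex \<times> complex \<Rightarrow> complex \<times> complex \<Rightarrow> complex) \<Rightarrow>
   (complex \<times> complex \<Rightarrow> complex \<times> complex \<Rightarrow> complex) \<Rightarrow> bool" where
  "agler_kernels \<theta> K1 K2 \<longleftrightarrow>
     positive_kernel_on bidisk K1 \<and> positive_kernel_on bidisk K2 \<and>
     (\<forall>z\<in>bidisk. \<forall>w\<in>bidisk.
        1 - \<theta> z * cnj (\<theta> w) =
          (1 - fst z * cnj (fst w)) * K2 z w + (1 - snd z * cnj (snd w)) * K1 z w)"

end

theory Submission
  imports Defs "HOL-Complex_Analysis.Cauchy_Integral_Formula"
    "HOL-Probability.Probability_Measure" "HOL-Real_Asymp.Real_Asymp"
begin

text \<open>If \<open>\<theta> = \<phi>(z\<^sub>1) \<psi>(z\<^sub>2)\<close>, then \<open>1 - \<theta>\<theta>\<^sup>* = (1 - \<psi>\<psi>\<^sup>*) + \<psi>\<psi>\<^sup>*(1 - \<phi>\<phi>\<^sup>*)\<close>, and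
  dividing by the Szego denominators gives Agler kernels by Pick's theorem. Conversely, letting
  \<open>z\<^sub>1 = w\<^sub>1 = r\<tau>\<^sub>1\<close> with \<open>r \<rightarrow> 1\<close> in the Agler identity shows that, for almost every \<open>\<tau>\<^sub>1\<close>,
  \<open>\<theta>(r\<tau>\<^sub>1, z\<^sub>2) \<theta>(r\<tau>\<^sub>1, w\<^sub>2)\<^sup>*\<close> tends to a function \<open>L(z\<^sub>2, w\<^sub>2)\<close> independent of \<open>\<tau>\<^sub>1\<close>. For
  \<open>w\<^sub>0\<close> with \<open>L(w\<^sub>0, w\<^sub>0) = s\<^sup>2 > 0\<close>, the function \<open>\<theta>(z\<^sub>1, z\<^sub>2) - \<theta>(z\<^sub>1, w\<^sub>0) L(z\<^sub>2, w\<^sub>0) / s\<^sup>2\<close>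
  has vanishing radial limits in \<open>z\<^sub>1\<close>, hence is zero.\<close>

section \<open>Integration over the circle and the Cauchy formula\<close>

interpretation circle: prob_space circle_measure
  by (rule prob_spaceI) (rule emeasure_space_circle_measure)

interpretation torus: pair_prob_space circle_measure circle_measure ..

lemma borel_measurable_circle_measure:
  fixes g :: "complex \<Rightarrow> 'a::topological_space"
  assumes "continuous_on (sphere 0 1) g"
  shows "g \<in> borel_measurable circle_measure"
  using borel_measurable_continuous_on_restrict[OF assms]
  by (simp add: measurable_cong_sets[OF sets_circle_measure])

text \<open>The bridge from \<open>circle_measure\<close> to contour integrals: pulled back along
  \<open>cis\<close>, the measure has constant density 1/(2 pi) on [0, 2 pi).\<close>

lemma integral_circle_measure:
  fixes g :: "complex \<Rightarrow> complex"
  assumes g: "continuous_on (sphere 0 1) g"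
  shows "((\<lambda>t. g (cis t)) has_integral 2 * pi * (\<integral>\<tau>. g \<tau> \<partial>circle_measure)) {0..2*pi}"
proof -
  have cis: "cis \<in> borel_measurable borel"
    by (intro borel_measurable_continuous_onI continuous_intros)
  then have m: "cis \<in> lborel \<rightarrow>\<^sub>M restrict_space borel (sphere 0 1)"
    by (intro measurable_restrict_space2) auto
  then have m': "cis \<in> uniform_measure lborel {0..<2*pi} \<rightarrow>\<^sub>M restrict_space borel (sphere 0 1)"
    by (simp add: measurable_def)
  have gm: "g \<in> borel_measurable (restrict_space borel (sphere 0 1))"
    by (rule borel_measurable_continuous_on_restrict[OF g])
  have gc: "(\<lambda>t. g (cis t)) \<in> borel_measurable lborel"
    using measurable_comp[OF m gm] by (simp add: comp_def)
  have u: "uniform_measure lborel {0..<2*pi} =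
      density lborel (\<lambda>x. ennreal (indicator {0..<2*pi} x / (2*pi)))"
    unfolding uniform_measure_def
    by (rule arg_cong[where f="density lborel"])
       (auto simp: fun_eq_iff divide_ennreal ennreal_divide_times indicator_def simp flip: ennreal_1 intro!: divide_ennreal)
  have cc: "continuous_on {0..2*pi} (\<lambda>t. g (cis t))"
    by (rule continuous_on_compose2[OF g]) (auto intro!: continuous_intros)
  have "(\<integral>\<tau>. g \<tau> \<partial>circle_measure) = (\<integral>t. (indicator {0..<2*pi} t / (2*pi)) *\<^sub>R g (cis t) \<partial>lborel)"
    unfolding circle_measure_def integral_distr[OF m' gm] unfolding u
    by (subst integral_density) (use gc in auto)
  also have "\<dots> = (\<integral>t. (1 / (2*pi)) *\<^sub>R (indicator {0..<2*pi} t *\<^sub>R g (cis t)) \<partial>lborel)"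
    by (intro Bochner_Integration.integral_cong) auto
  also have "\<dots> = (1 / (2*pi)) *\<^sub>R (\<integral>t. indicator {0..<2*pi} t *\<^sub>R g (cis t) \<partial>lborel)"
    by (rule Bochner_Integration.integral_scaleR_right)
  \<comment> \<open>Contour integrals use the closed interval; the added endpoint is a null
    set.\<close>
  also have "(\<integral>t. indicator {0..<2*pi} t *\<^sub>R g (cis t) \<partial>lborel)
      = (\<integral>t. indicator {0..2*pi} t *\<^sub>R g (cis t) \<partial>lborel)"
    by (rule integral_discrete_difference[of "{2*pi}"]) (auto simp: indicator_def)
  also have "\<dots> = integral {0..2*pi} (\<lambda>t. g (cis t))"
    using set_borel_integral_eq_integral(2)[OF borel_integrable_atLeastAtMost'[OF cc]]
    by (simp add: set_lebesgue_integral_def)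
  finally have "2 * pi * (\<integral>\<tau>. g \<tau> \<partial>circle_measure) = integral {0..2*pi} (\<lambda>t. g (cis t))"
    by (simp add: scaleR_conv_of_real)
  then show ?thesis
    using integrable_continuous_interval[OF cc] by (simp add: has_integral_integrable_integral)
qed

lemma circle_kernel_nonzero:
  assumes "cmod w < 1" "cmod \<tau> \<le> 1"
  shows "1 - w * cnj \<tau> \<noteq> 0"
proof
  assume "1 - w * cnj \<tau> = 0"
  then have "w * cnj \<tau> = 1" by simp
  then have "cmod w * cmod \<tau> = 1"
    by (metis complex_mod_cnj norm_mult norm_one)
  then show False
    using assms by (smt (verit) mult_left_le norm_ge_zero)
qed

text \<open>On the circle \<open>cnj \<tau>\<close> is the inverse of \<tau>, so with \<tau> =
  \<open>cis t\<close> the form d\<tau> / (\<tau> - w) becomes i dt / (1 - w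
  \<open>cnj \<tau>\<close>), and Cauchy's formula turns into an average over normalised arc
  length.\<close>

lemma Cauchy_integral_circle_measure:
  assumes contf: "continuous_on (cball 0 1) f" and holf: "f holomorphic_on unit_disk"
    and w: "cmod w < 1"
  shows "(\<integral>\<tau>. f \<tau> / (1 - w * cnj \<tau>) \<partial>circle_measure) = f w"
proof -
  let ?I = "\<integral>\<tau>. f \<tau> / (1 - w * cnj \<tau>) \<partial>circle_measure"
  have "continuous_on (sphere 0 1) (\<lambda>\<tau>. f \<tau> / (1 - w * cnj \<tau>))"
    using circle_kernel_nonzero[OF w]
    by (intro continuous_intros continuous_on_subset[OF contf]) auto
  from integral_circle_measure[OF this]
  have "((\<lambda>t. \<i> * (f (cis t) / (1 - w * cnj (cis t)))) has_integral \<i> * (2 * pi * ?I)) {0..2*pi}"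
    by (rule has_integral_mult_right)
  \<comment> \<open>The right side is spelled as the integrand along \<open>circlepath 0 1\<close>:
    centre 0, radius 1 and velocity \<open>\<i> * cis t\<close>.\<close>
  moreover have "\<i> * (f (cis t) / (1 - w * cnj (cis t))) =
      f (0 + 1 * cis t) / (0 + 1 * cis t - w) * 1 * \<i> * cis t" for t
  proof -
    have "cis t * (1 - w * cnj (cis t)) = cis t - w"
      by (simp add: algebra_simps cis_cnj cis_mult)
    moreover have "cis t - w \<noteq> 0" using w by (metis norm_cis eq_iff_diff_eq_0 less_irrefl)
    moreover have "1 - w * cnj (cis t) \<noteq> 0"
      by (rule circle_kernel_nonzero[OF w]) simp
    ultimately show ?thesis by (simp add: divide_simps)
  qed
  ultimately have "((\<lambda>t. f (0 + 1 * cis t) / (0 + 1 * cis t - w) * 1 * \<i> * cis t)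
      has_integral \<i> * (2 * pi * ?I)) {0..2*pi}"
    by simp
  then have "((\<lambda>u. f u / (u - w)) has_contour_integral \<i> * (2 * pi * ?I)) (circlepath 0 1)"
    unfolding circlepath_def
    by (subst has_contour_integral_part_circlepath_iff) auto
  moreover have "((\<lambda>u. f u/(u-w)) has_contour_integral (2 * of_real pi * \<i> * f w)) (circlepath 0 1)"
    by (rule Cauchy_integral_circlepath) (use assms in auto)
  ultimately have "\<i> * (2 * pi * ?I) = 2 * of_real pi * \<i> * f w"
    by (rule has_contour_integral_unique)
  then show ?thesis by simp
qed

section \<open>Radial limits of bounded holomorphic functions on the disk\<close>

lemma of_real_mult_in_unit_disk:
  assumes "0 < r" "r < 1" "cmod z \<le> 1"
  shows "of_real r * z \<in> unit_disk"
proof -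
  have "r * cmod z < 1"
    using assms by (smt (verit) mult_left_le)
  then show ?thesis using assms by (simp add: norm_mult)
qed

text \<open>Holomorphy on the open disk says nothing about the boundary, but the dilates are
  continuous on the closed disk, as the Cauchy formula on the circle requires.\<close>

lemma dilation:
  assumes f: "f holomorphic_on unit_disk" and r: "0 < r" "r < 1"
  shows "continuous_on (cball 0 1) (\<lambda>z. f (of_real r * z))"
    and "(\<lambda>z. f (of_real r * z)) holomorphic_on unit_disk"
proof -
  show "continuous_on (cball 0 1) (\<lambda>z. f (of_real r * z))"
    by (rule continuous_on_compose2[OF holomorphic_on_imp_continuous_on[OF f]])
       (use of_real_mult_in_unit_disk[OF r] in \<open>auto intro!: continuous_intros\<close>)
  show "(\<lambda>z. f (of_real r * z)) holomorphic_on unit_disk"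
    by (rule holomorphic_on_compose_gen[OF _ f, unfolded comp_def])
       (use of_real_mult_in_unit_disk[OF r] in \<open>auto intro!: holomorphic_intros\<close>)
qed

lemma eventually_at_left_1: "eventually (\<lambda>r::real. 0 < r \<and> r < 1) (at_left 1)"
  using eventually_at_left_real[of 0 "1::real"] by (simp add: greaterThanLessThan_def)

lemma tendsto_radial:
  assumes f: "f holomorphic_on unit_disk" and w: "w \<in> unit_disk"
  shows "((\<lambda>r. f (of_real r * w)) \<longlongrightarrow> f w) (at_left 1)"
proof -
  have "isCont f w"
    using f w by (meson holomorphic_on_imp_continuous_on continuous_on_eq_continuous_at open_ball)
  moreover have "((\<lambda>r. of_real r * w) \<longlongrightarrow> of_real 1 * w) (at_left 1)"
    by (intro tendsto_intros)
  ultimately show ?thesis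
    using isCont_tendsto_compose by fastforce
qed

lemma norm_cauchy_kernel_le:
  assumes "cmod w < 1" "cmod \<tau> = 1"
  shows "cmod (c / (1 - w * cnj \<tau>)) \<le> cmod c / (1 - cmod w)"
proof -
  have "cmod (w * cnj \<tau>) = cmod w"
    using assms by (simp add: norm_mult)
  then have "1 - cmod w \<le> cmod (1 - w * cnj \<tau>)"
    using norm_triangle_ineq2[of 1 "w * cnj \<tau>"] by simp
  then show ?thesis
    using assms by (auto simp: norm_divide intro!: frac_le)
qed

text \<open>Matches the scalar in the limit conditions with the factor
  \<open>1 - fst z * cnj (fst w)\<close> of the Agler identity when both first coordinates are
  \<open>of_real r * \<tau>\<close>.\<close>

lemma radial_mult_cnj:
  "of_real r * \<tau> * cnj (of_real r * \<tau>) = of_real (r\<^sup>2 * (cmod \<tau>)\<^sup>2)"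
  unfolding complex_norm_square[of "of_real r * \<tau>", symmetric]
  by (simp add: norm_mult power_mult_distrib)

lemma cauchy_kernel_measurable:
  "(\<lambda>\<tau>. 1 - w * cnj \<tau>) \<in> borel_measurable circle_measure"
  by (intro borel_measurable_circle_measure continuous_intros)

lemma radial_measurable:
  assumes "f holomorphic_on unit_disk" "0 < r" "r < 1"
  shows "(\<lambda>\<tau>. f (of_real r * \<tau>)) \<in> borel_measurable circle_measure"
  by (intro borel_measurable_circle_measure continuous_on_subset[OF dilation(1)[OF assms]]) auto

text \<open>Dominated convergence in the Cauchy formula for the dilates. The factor
  \<open>u r\<close> depends on the radius alone and so passes through the integral; it allows
  products in which the convergence of \<open>u\<close> itself is still unknown.\<close>

lemma radial_limit_Cauchy:
  fixes u :: "real \<Rightarrow> complex"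
  assumes f: "f holomorphic_on unit_disk" and bf: "bounded (f ` unit_disk)"
    and w: "w \<in> unit_disk"
    and u: "\<And>r. 0 < r \<Longrightarrow> r < 1 \<Longrightarrow> cmod (u r) \<le> B"
    and l: "l \<in> borel_measurable circle_measure"
    and lim: "AE \<tau> in circle_measure. ((\<lambda>r. f (of_real r * \<tau>) * u r) \<longlongrightarrow> l \<tau>) (at_left 1)"
  shows "((\<lambda>r. f (of_real r * w) * u r) \<longlongrightarrow>
           (\<integral>\<tau>. l \<tau> / (1 - w * cnj \<tau>) \<partial>circle_measure)) (at_left 1)"
\<comment> \<open>Dominated convergence concerns sequences, so the left limit is tested along
  sequences in (0, 1) that tend to 1.\<close>
proof (rule tendsto_at_left_sequentially[of 0])
  fix S :: "nat \<Rightarrow> real"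
  assume S1: "\<And>n. S n < 1" and S0: "\<And>n. 0 < S n" and S: "S \<longlonglongrightarrow> 1"
  have fS: "filterlim S (at_left 1) sequentially"
    using S S1 by (auto simp: filterlim_at eventually_at_filter intro!: always_eventually)
      (simp add: less_imp_neq S1)
  obtain A where A: "\<And>z. z \<in> unit_disk \<Longrightarrow> cmod (f z) \<le> A"
    using bf unfolding bounded_iff by blast
  have w1: "cmod w < 1" using w by simp
  have "(\<lambda>n. \<integral>\<tau>. f (of_real (S n) * \<tau>) * u (S n) / (1 - w * cnj \<tau>) \<partial>circle_measure)
      \<longlonglongrightarrow> (\<integral>\<tau>. l \<tau> / (1 - w * cnj \<tau>) \<partial>circle_measure)"
  proof (rule integral_dominated_convergence[where w="\<lambda>_. A * B / (1 - cmod w)"])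
    show "AE \<tau> in circle_measure. (\<lambda>n. f (of_real (S n) * \<tau>) * u (S n) / (1 - w * cnj \<tau>))
        \<longlonglongrightarrow> l \<tau> / (1 - w * cnj \<tau>)"
      using lim AE_space
    proof eventually_elim
      case (elim \<tau>)
      show ?case
        by (intro tendsto_divide filterlim_compose[OF elim(1) fS] tendsto_const)
           (use circle_kernel_nonzero[OF w1, of \<tau>] elim(2) in simp)
    qed
    show "AE \<tau> in circle_measure. cmod (f (of_real (S n) * \<tau>) * u (S n) / (1 - w * cnj \<tau>))
        \<le> A * B / (1 - cmod w)" for n
      using AE_space
    proof eventually_elim
      case (elim \<tau>)
      then have t: "cmod \<tau> = 1" by simp
      have "cmod (f (of_real (S n) * \<tau>)) * cmod (u (S n)) \<le> A * B"
        using A[OF of_real_mult_in_unit_disk[OF S0 S1, of \<tau>]] u[OF S0 S1] t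
        by (intro mult_mono) (auto intro: order_trans[OF norm_ge_zero])
      then show ?case
        using w1 by (intro order_trans[OF norm_cauchy_kernel_le[OF w1 t]] divide_right_mono)
          (auto simp: norm_mult)
    qed
  qed (intro borel_measurable_divide borel_measurable_times borel_measurable_const l
      cauchy_kernel_measurable radial_measurable[OF f S0 S1] circle.integrable_const)+
  moreover have "(\<integral>\<tau>. f (of_real (S n) * \<tau>) * u (S n) / (1 - w * cnj \<tau>) \<partial>circle_measure)
      = f (of_real (S n) * w) * u (S n)" for n
    by (rule Cauchy_integral_circle_measure)
       (intro continuous_intros holomorphic_intros dilation[OF f S0 S1] w1)+
  ultimately show "(\<lambda>n. f (of_real (S n) * w) * u (S n))
      \<longlonglongrightarrow> (\<integral>\<tau>. l \<tau> / (1 - w * cnj \<tau>) \<partial>circle_measure)"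
    by simp
qed simp

text \<open>The limit along one fixed sequence is measurable in \<tau>, being a limit of measurable
  functions, and it agrees with the radial limit wherever the latter exists.\<close>

lemma radial_limit_measurable:
  fixes u :: "real \<Rightarrow> complex"
  assumes f: "f holomorphic_on unit_disk"
    and lim: "AE \<tau> in circle_measure. \<exists>l. ((\<lambda>r. f (of_real r * \<tau>) * u r) \<longlongrightarrow> l) (at_left 1)"
  obtains l where "l \<in> borel_measurable circle_measure"
    "AE \<tau> in circle_measure. ((\<lambda>r. f (of_real r * \<tau>) * u r) \<longlongrightarrow> l \<tau>) (at_left 1)"
proof -
  \<comment> \<open>The offset 2 keeps every term, also that for n = 0, strictly between 0 and
    1.\<close>
  define S :: "nat \<Rightarrow> real" where "S n = 1 - 1 / (real n + 2)" for n
  have S: "0 < S n" "S n < 1" for n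
    by (auto simp: S_def field_simps)
  have "S \<longlonglongrightarrow> 1 - 0"
    unfolding S_def by (intro tendsto_diff tendsto_const) real_asymp
  then have fS: "filterlim S (at_left 1) sequentially"
    using S by (auto simp: filterlim_at eventually_at_filter intro!: always_eventually)
      (simp add: less_imp_neq)
  define l where "l \<tau> = lim (\<lambda>n. f (of_real (S n) * \<tau>) * u (S n))" for \<tau>
  note [measurable] = radial_measurable[OF f S]
  have "l \<in> borel_measurable circle_measure"
    unfolding l_def by measurable
  moreover have "AE \<tau> in circle_measure. ((\<lambda>r. f (of_real r * \<tau>) * u r) \<longlongrightarrow> l \<tau>) (at_left 1)"
    using lim
  proof eventually_elim
    case (elim \<tau>)
    then obtain m where m: "((\<lambda>r. f (of_real r * \<tau>) * u r) \<longlongrightarrow> m) (at_left 1)"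
      by blast
    moreover have "l \<tau> = m"
      unfolding l_def by (rule limI, rule filterlim_compose[OF m fS])
    ultimately show ?case by simp
  qed
  ultimately show ?thesis by (rule that)
qed

text \<open>A bounded holomorphic function with radial limits almost everywhere is their Cauchy
  integral, so it vanishes when they do.\<close>

lemma radial_limit_zero:
  assumes f: "f holomorphic_on unit_disk" "bounded (f ` unit_disk)"
    and lim: "AE \<tau> in circle_measure. ((\<lambda>r. f (of_real r * \<tau>)) \<longlongrightarrow> 0) (at_left 1)"
    and w: "w \<in> unit_disk"
  shows "f w = 0"
proof -
  have "((\<lambda>r. f (of_real r * w) * 1) \<longlongrightarrow>
           (\<integral>\<tau>. 0 / (1 - w * cnj \<tau>) \<partial>circle_measure)) (at_left 1)"
    by (rule radial_limit_Cauchy[OF f w, where B=1]) (use lim in auto)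
  then have "((\<lambda>r. f (of_real r * w)) \<longlongrightarrow> 0) (at_left 1)"
    by simp
  then show ?thesis
    using tendsto_unique[OF _ tendsto_radial[OF f(1) w]] by simp
qed


text \<open>The Cauchy kernel only gives \<open>cmod (f w) \<le> 1 / (1 - cmod w)\<close>; applying the estimate to all
  powers of \<open>f\<close> removes the constant.\<close>

lemma inner_disk_norm_le_1:
  assumes f: "inner_disk f" and w: "w \<in> unit_disk"
  shows "cmod (f w) \<le> 1"
proof (rule ccontr)
  assume "\<not> cmod (f w) \<le> 1"
  then obtain n where n: "1 / (1 - cmod w) < cmod (f w) ^ n"
    using real_arch_pow[of "cmod (f w)"] by auto
  have holf: "f holomorphic_on unit_disk" and bf: "bounded (f ` unit_disk)"
    and ae: "AE \<tau> in circle_measure. \<exists>l. cmod l = 1 \<and> ((\<lambda>r. f (of_real r * \<tau>)) \<longlongrightarrow> l) (at_left 1)"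
    using f by (auto simp: inner_disk_def)
  have w1: "cmod w < 1" using w by simp
  have "AE \<tau> in circle_measure. \<exists>l. ((\<lambda>r. f (of_real r * \<tau>) * 1) \<longlongrightarrow> l) (at_left 1)"
    using ae by eventually_elim auto
  then obtain l where l[measurable]: "l \<in> borel_measurable circle_measure"
    and lim: "AE \<tau> in circle_measure. ((\<lambda>r. f (of_real r * \<tau>) * 1) \<longlongrightarrow> l \<tau>) (at_left 1)"
    by (rule radial_limit_measurable[OF holf])
  note [measurable] = cauchy_kernel_measurable
  have l1: "AE \<tau> in circle_measure. cmod (l \<tau>) = 1"
    using ae lim
  proof eventually_elim
    case (elim \<tau>)
    then show ?case
      using tendsto_unique[of "at_left (1::real)"] by fastforce
  qed
  let ?I = "\<integral>\<tau>. l \<tau> ^ n / (1 - w * cnj \<tau>) \<partial>circle_measure"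
  obtain A where A: "\<And>z. z \<in> unit_disk \<Longrightarrow> cmod (f z) \<le> A"
    using bf unfolding bounded_iff by blast
  have "((\<lambda>r. f (of_real r * w) ^ n * 1) \<longlongrightarrow> ?I) (at_left 1)"
  proof (rule radial_limit_Cauchy[OF _ _ w, where B=1])
    show "(\<lambda>z. f z ^ n) holomorphic_on unit_disk"
      by (intro holomorphic_intros holf)
    show "bounded ((\<lambda>z. f z ^ n) ` unit_disk)"
      unfolding bounded_iff
      by (rule exI[of _ "A ^ n"]) (auto simp: norm_power intro!: power_mono A)
    show "AE \<tau> in circle_measure. ((\<lambda>r. f (of_real r * \<tau>) ^ n * 1) \<longlongrightarrow> l \<tau> ^ n) (at_left 1)"
      using lim by eventually_elim (auto intro: tendsto_power)
  qed auto
  moreover have "((\<lambda>r. f (of_real r * w) ^ n * 1) \<longlongrightarrow> f w ^ n) (at_left 1)"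
    using tendsto_power[OF tendsto_radial[OF holf w]] by simp
  ultimately have "f w ^ n = ?I"
    using tendsto_unique[of "at_left (1::real)"] by fastforce
  moreover have b: "AE \<tau> in circle_measure. cmod (l \<tau> ^ n / (1 - w * cnj \<tau>)) \<le> 1 / (1 - cmod w)"
    using l1 AE_space
  proof eventually_elim
    case (elim \<tau>)
    then show ?case
      using norm_cauchy_kernel_le[OF w1, of \<tau> "l \<tau> ^ n"] by (simp add: norm_power)
  qed
  have "integrable circle_measure (\<lambda>\<tau>. l \<tau> ^ n / (1 - w * cnj \<tau>))"
    by (rule circle.integrable_const_bound[OF b]) measurable
  then have "cmod ?I \<le> 1 / (1 - cmod w)"
    by (intro order_trans[OF integral_norm_bound] circle.integral_le_const b) auto
  ultimately show False
    using n by (simp add: norm_power[symmetric])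
qed

section \<open>The Szego kernel and Pick's theorem\<close>

lemma integrable_circle_measure:
  fixes g :: "complex \<Rightarrow> complex"
  assumes "continuous_on (sphere 0 1) g"
  shows "integrable circle_measure g"
proof -
  have "bounded (g ` sphere 0 1)"
    by (intro compact_imp_bounded compact_continuous_image assms) simp
  then obtain B where "\<And>z. z \<in> sphere 0 1 \<Longrightarrow> cmod (g z) \<le> B"
    unfolding bounded_iff by blast
  then show ?thesis
    by (intro circle.integrable_const_bound[of _ B] AE_I2 borel_measurable_circle_measure assms) simp
qed

text \<open>Conjugation turns Szego kernels into Cauchy kernels, so pairing with a combination of
  them evaluates \<open>f\<close> at the points \<open>s w\<close>. These form an indexed family,
  possibly with repetitions, so that kernels pulled back along a coordinate of the bidisk are
  covered.\<close>

lemma Szego_reproducing: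
  assumes contf: "continuous_on (cball 0 1) f" and holf: "f holomorphic_on unit_disk"
    and s: "finite F" "s ` F \<subseteq> unit_disk"
  shows "(\<integral>\<tau>. f \<tau> * cnj (\<Sum>w\<in>F. cnj (a w) / (1 - \<tau> * cnj (s w))) \<partial>circle_measure)
      = (\<Sum>w\<in>F. a w * f (s w))"
proof -
  have s1: "cmod (s w) < 1" if "w \<in> F" for w using s(2) that by force
  have c: "continuous_on (sphere 0 1) (\<lambda>\<tau>. f \<tau> / (1 - s w * cnj \<tau>))" if "w \<in> F" for w
    using circle_kernel_nonzero[OF s1[OF that]]
    by (intro continuous_intros continuous_on_subset[OF contf]) auto
  have "(\<integral>\<tau>. f \<tau> * cnj (\<Sum>w\<in>F. cnj (a w) / (1 - \<tau> * cnj (s w))) \<partial>circle_measure)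
      = (\<integral>\<tau>. (\<Sum>w\<in>F. a w * (f \<tau> / (1 - s w * cnj \<tau>))) \<partial>circle_measure)"
    by (simp add: sum_distrib_left mult_ac)
  also have "\<dots> = (\<Sum>w\<in>F. \<integral>\<tau>. a w * (f \<tau> / (1 - s w * cnj \<tau>)) \<partial>circle_measure)"
    by (intro Bochner_Integration.integral_sum integrable_mult_right integrable_circle_measure c)
  also have "\<dots> = (\<Sum>w\<in>F. a w * f (s w))"
    by (intro sum.cong refl)
       (simp only: integral_mult_right_zero Cauchy_integral_circle_measure[OF contf holf s1])
  finally show ?thesis .
qed

text \<open>With \<open>M\<close> the multiplication by \<open>f\<close> on the Hardy space, \<open>g = M\<^sup>* H\<close> below, and the quadratic
  form equals \<open>\<parallel>H\<parallel>\<^sup>2 - \<parallel>g\<parallel>\<^sup>2 \<ge> \<parallel>H - f g\<parallel>\<^sup>2\<close>.\<close>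

lemma Pick_positive_closed_disk:
  assumes contf: "continuous_on (cball 0 1) f" and holf: "f holomorphic_on unit_disk"
    and f1: "\<And>z. z \<in> sphere 0 1 \<Longrightarrow> cmod (f z) \<le> 1"
    and s: "finite F" "s ` F \<subseteq> unit_disk"
  shows "(\<Sum>z\<in>F. \<Sum>w\<in>F. c z * cnj (c w) *
      ((1 - f (s z) * cnj (f (s w))) / (1 - s z * cnj (s w)))) \<in> \<real>\<^sub>\<ge>\<^sub>0" (is "?S \<in> _")
proof -
  define H where "H \<zeta> = (\<Sum>w\<in>F. cnj (c w) / (1 - \<zeta> * cnj (s w)))" for \<zeta>
  define g where "g \<zeta> = (\<Sum>w\<in>F. cnj (c w * f (s w)) / (1 - \<zeta> * cnj (s w)))" for \<zeta>
  define S1 where "S1 = (\<Sum>z\<in>F. c z * H (s z))"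
  define S2 where "S2 = (\<Sum>z\<in>F. c z * f (s z) * g (s z))"
  have nz: "1 - \<zeta> * cnj (s w) \<noteq> 0" if "w \<in> F" "cmod \<zeta> \<le> 1" for w \<zeta>
  proof -
    have "cmod (s w) < 1" using s(2) that by force
    from circle_kernel_nonzero[OF this that(2)] show ?thesis
      by (metis complex_cnj_cnj complex_cnj_diff complex_cnj_mult complex_cnj_one complex_cnj_zero mult.commute)
  qed
  have Hc: "continuous_on (cball 0 1) H" and gc: "continuous_on (cball 0 1) g"
    unfolding H_def g_def using nz by (auto intro!: continuous_intros)
  have Hh: "H holomorphic_on unit_disk" and gh: "g holomorphic_on unit_disk"
    unfolding H_def g_def using nz by (auto intro!: holomorphic_intros)
  have fgc: "continuous_on (cball 0 1) (\<lambda>z. f z * g z)"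
    and fgh: "(\<lambda>z. f z * g z) holomorphic_on unit_disk"
    using contf gc holf gh by (auto intro!: continuous_intros holomorphic_intros)
  have HH: "(\<integral>\<tau>. H \<tau> * cnj (H \<tau>) \<partial>circle_measure) = S1"
    using Szego_reproducing[OF Hc Hh s, of c] by (simp add: S1_def H_def)
  \<comment> \<open>Both this integral and the next one equal \<open>S2\<close>: with
    \<open>g\<close> the adjoint of multiplication by \<open>f\<close> applied to \<open>H\<close>,
    they are the inner products of \<open>f g\<close> with \<open>H\<close> and of \<open>g\<close>
    with itself.\<close>
  have fgH: "(\<integral>\<tau>. f \<tau> * g \<tau> * cnj (H \<tau>) \<partial>circle_measure) = S2"
    using Szego_reproducing[OF fgc fgh s, of c] by (simp add: S2_def H_def mult.assoc)
  have gg: "(\<integral>\<tau>. g \<tau> * cnj (g \<tau>) \<partial>circle_measure) = S2"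
    using Szego_reproducing[OF gc gh s, of "\<lambda>w. c w * f (s w)"] by (simp add: S2_def g_def)
  have sub: "sphere 0 1 \<subseteq> cball (0::complex) 1" by auto
  note cs = continuous_on_subset[OF Hc sub] continuous_on_subset[OF gc sub]
    continuous_on_subset[OF contf sub]
  have iHH: "integrable circle_measure (\<lambda>\<tau>. H \<tau> * cnj (H \<tau>))"
    and ifgH: "integrable circle_measure (\<lambda>\<tau>. f \<tau> * g \<tau> * cnj (H \<tau>))"
    and igg: "integrable circle_measure (\<lambda>\<tau>. g \<tau> * cnj (g \<tau>))"
    by (intro integrable_circle_measure continuous_intros cs)+
  \<comment> \<open>Both are squared norms, hence real; it remains to compare them.\<close>
  have "Im S1 = 0" "Im S2 = 0"
    unfolding HH[symmetric] gg[symmetric] integral_Im[OF iHH, symmetric] integral_Im[OF igg, symmetric]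
    by simp_all
  moreover have "0 \<le> Re (S1 - S2)"
  proof -
    \<comment> \<open>The integral is \<open>S1 - 2 * S2 + S2\<close>, and the real part of the
      integrand is |H - f g|^2 + |g|^2 - |f g|^2, which is nonnegative because |f| is at most 1 on
      the circle.\<close>
    let ?T = "\<lambda>\<tau>. H \<tau> * cnj (H \<tau>) - 2 * (f \<tau> * g \<tau> * cnj (H \<tau>)) + g \<tau> * cnj (g \<tau>)"
    have iT: "integrable circle_measure ?T"
      by (intro Bochner_Integration.integrable_add Bochner_Integration.integrable_diff
          integrable_mult_right iHH ifgH igg)
    have "S1 - S2 = (\<integral>\<tau>. ?T \<tau> \<partial>circle_measure)"
      by (simp add: HH fgH gg iHH ifgH igg integrable_mult_right)
    moreover have "0 \<le> Re (?T \<tau>)" if "\<tau> \<in> space circle_measure" for \<tau>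
    proof -
      have "cmod (f \<tau> * g \<tau>) \<le> cmod (g \<tau>)"
        using f1[of \<tau>] that by (simp add: norm_mult mult_left_le_one_le)
      then have "(cmod (f \<tau> * g \<tau>))\<^sup>2 \<le> (cmod (g \<tau>))\<^sup>2"
        by (intro power_mono) auto
      moreover have "0 \<le> (cmod (H \<tau> - f \<tau> * g \<tau>))\<^sup>2" by simp
      ultimately show ?thesis
        unfolding cmod_power2 by (simp add: power2_eq_square algebra_simps)
    qed
    ultimately show ?thesis
      using integral_Re[OF iT] by (metis (no_types, lifting) Bochner_Integration.integral_nonneg)
  qed
  moreover have "?S = S1 - S2"
    unfolding S1_def S2_def H_def g_def sum_distrib_left sum_subtractf[symmetric]
    by (intro sum.cong refl) (simp add: diff_divide_distrib algebra_simps)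
  ultimately show ?thesis
    by (simp add: complex_nonneg_Reals_iff)
qed

text \<open>The dilates of \<open>f\<close> fall under the closed-disk case; as r tends to 1 the
  finite quadratic form converges term by term, and the nonnegative reals are closed.\<close>

lemma Pick_positive:
  assumes holf: "f holomorphic_on unit_disk"
    and f1: "\<And>z. z \<in> unit_disk \<Longrightarrow> cmod (f z) \<le> 1"
    and s: "finite F" "s ` F \<subseteq> unit_disk"
  shows "(\<Sum>z\<in>F. \<Sum>w\<in>F. c z * cnj (c w) *
      ((1 - f (s z) * cnj (f (s w))) / (1 - s z * cnj (s w)))) \<in> \<real>\<^sub>\<ge>\<^sub>0"
proof (rule Lim_in_closed_set[OF closed_nonneg_Reals_complex _ trivial_limit_at_left_real[of 1]])
  let ?S = "\<lambda>r. \<Sum>z\<in>F. \<Sum>w\<in>F. c z * cnj (c w) *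
      ((1 - f (of_real r * s z) * cnj (f (of_real r * s w))) / (1 - s z * cnj (s w)))"
  show "eventually (\<lambda>r. ?S r \<in> \<real>\<^sub>\<ge>\<^sub>0) (at_left 1)"
    using eventually_at_left_1
  proof eventually_elim
    case (elim r)
    show ?case
      by (rule Pick_positive_closed_disk[where f="\<lambda>z. f (of_real r * z)"])
         (use elim s dilation[OF holf] f1 of_real_mult_in_unit_disk[of r] in \<open>auto simp del: mem_ball\<close>)
  qed
  show "(?S \<longlongrightarrow> (\<Sum>z\<in>F. \<Sum>w\<in>F. c z * cnj (c w) *
      ((1 - f (s z) * cnj (f (s w))) / (1 - s z * cnj (s w))))) (at_left 1)"
  proof (intro tendsto_sum tendsto_mult tendsto_const)
    fix z w assume "z \<in> F" "w \<in> F"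
    then have "s z \<in> unit_disk" "s w \<in> unit_disk" using s(2) by auto
    note t = tendsto_radial[OF holf this(1)] tendsto_radial[OF holf this(2)]
    have "1 - s z * cnj (s w) \<noteq> 0"
      using \<open>s z \<in> unit_disk\<close> \<open>s w \<in> unit_disk\<close> by (intro circle_kernel_nonzero) auto
    then show "((\<lambda>r. (1 - f (of_real r * s z) * cnj (f (of_real r * s w))) / (1 - s z * cnj (s w)))
        \<longlongrightarrow> (1 - f (s z) * cnj (f (s w))) / (1 - s z * cnj (s w))) (at_left 1)"
      by (intro tendsto_intros t)
  qed
qed

section \<open>Functions on the bidisk, their slices and factors\<close>

lemma mem_bidisk: "z \<in> bidisk \<longleftrightarrow> fst z \<in> unit_disk \<and> snd z \<in> unit_disk"
  by (cases z) (simp add: bidisk_def)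

lemma open_bidisk: "open bidisk"
  by (simp add: bidisk_def open_Times)

lemma holomorphic2_on_bidiskD:
  assumes "\<theta> holomorphic2_on bidisk" "z \<in> bidisk"
  obtains a b where "(\<theta> has_derivative (\<lambda>h. a * fst h + b * snd h)) (at z)"
  using assms at_within_open[OF assms(2) open_bidisk] unfolding holomorphic2_on_def by metis

text \<open>Composing the total derivative with the embedding of a coordinate line leaves one of the
  coefficients \<open>a\<close>, \<open>b\<close> as complex derivative.\<close>

lemma holomorphic2_on_slices:
  assumes \<theta>: "\<theta> holomorphic2_on bidisk" and w: "w \<in> unit_disk"
  shows "(\<lambda>z. \<theta> (z, w)) holomorphic_on unit_disk" "(\<lambda>z. \<theta> (w, z)) holomorphic_on unit_disk"
proof -
  show "(\<lambda>z. \<theta> (z, w)) holomorphic_on unit_disk"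
    unfolding holomorphic_on_open[OF open_ball]
  proof
    fix z assume "z \<in> unit_disk"
    then have "(z, w) \<in> bidisk" using w by (simp add: mem_bidisk)
    then obtain a b where d: "(\<theta> has_derivative (\<lambda>h. a * fst h + b * snd h)) (at (z, w))"
      by (rule holomorphic2_on_bidiskD[OF \<theta>])
    have "((\<lambda>z. (z, w)) has_derivative (\<lambda>h. (h, 0))) (at z)"
      by (auto intro!: derivative_eq_intros)
    from has_derivative_compose[OF this d] show "\<exists>f'. ((\<lambda>z. \<theta> (z, w)) has_field_derivative f') (at z)"
      by (auto simp: has_field_derivative_def)
  qed
  show "(\<lambda>z. \<theta> (w, z)) holomorphic_on unit_disk"
    unfolding holomorphic_on_open[OF open_ball]
  proof
    fix z assume "z \<in> unit_disk"
    then have "(w, z) \<in> bidisk" using w by (simp add: mem_bidisk)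
    then obtain a b where d: "(\<theta> has_derivative (\<lambda>h. a * fst h + b * snd h)) (at (w, z))"
      by (rule holomorphic2_on_bidiskD[OF \<theta>])
    have "((\<lambda>z. (w, z)) has_derivative (\<lambda>h. (0, h))) (at z)"
      by (auto intro!: derivative_eq_intros)
    from has_derivative_compose[OF this d] show "\<exists>f'. ((\<lambda>z. \<theta> (w, z)) has_field_derivative f') (at z)"
      by (auto simp: has_field_derivative_def)
  qed
qed

text \<open>A condition that holds almost everywhere for a probability measure holds at some point
  of the torus; there the zero function would have limit 0 instead of a unimodular one.\<close>

lemma inner_bidisk_not_zero:
  assumes "inner_bidisk \<theta>"
  shows "\<exists>z\<in>bidisk. \<theta> z \<noteq> 0"
proof (rule ccontr)
  assume "\<not> ?thesis"
  then have 0: "\<theta> z = 0" if "z \<in> bidisk" for z using that by auto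
  have "AE \<tau> in circle_measure \<Otimes>\<^sub>M circle_measure. \<exists>l. cmod l = 1 \<and>
          ((\<lambda>r. \<theta> (of_real r * fst \<tau>, of_real r * snd \<tau>)) \<longlongrightarrow> l) (at_left 1)"
    using assms by (simp add: inner_bidisk_def)
  then have "\<exists>\<tau>. \<tau> \<in> space (circle_measure \<Otimes>\<^sub>M circle_measure) \<and> (\<exists>l. cmod l = 1 \<and>
          ((\<lambda>r. \<theta> (of_real r * fst \<tau>, of_real r * snd \<tau>)) \<longlongrightarrow> l) (at_left 1))"
    by (intro eventually_happens'[OF torus.ae_filter_bot] eventually_conj AE_space)
  then obtain \<tau> l where \<tau>: "cmod (fst \<tau>) = 1" "cmod (snd \<tau>) = 1" and l: "cmod l = 1"
    and lim: "((\<lambda>r. \<theta> (of_real r * fst \<tau>, of_real r * snd \<tau>)) \<longlongrightarrow> l) (at_left 1)"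
    by (auto simp: space_pair_measure)
  have "eventually (\<lambda>r. \<theta> (of_real r * fst \<tau>, of_real r * snd \<tau>) = 0) (at_left 1)"
    using eventually_at_left_1
    by eventually_elim
       (use 0 \<tau> of_real_mult_in_unit_disk in \<open>auto simp: mem_bidisk simp del: mem_ball\<close>)
  with lim have "((\<lambda>r. 0) \<longlongrightarrow> l) (at_left (1::real))"
    using tendsto_cong by force
  then have "l = 0"
    using tendsto_unique[of "at_left (1::real)"] by (metis tendsto_const trivial_limit_at_left_real)
  with l show False by simp
qed

text \<open>This replaces Fatou's theorem: along a generic \<open>\<tau>\<^sub>1\<close> the factor \<open>f (r \<tau>\<^sub>1)\<close> does not depend
  on \<open>\<tau>\<^sub>2\<close>, so by the Cauchy formula it converges as soon as the product does for almost
  every \<open>\<tau>\<^sub>2\<close>.\<close>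

lemma inner_bidisk_product_factors:
  assumes \<theta>: "inner_bidisk \<theta>"
    and eq: "\<And>z. z \<in> bidisk \<Longrightarrow> \<theta> z = f (fst z) * g (snd z)"
    and f: "f holomorphic_on unit_disk" "bounded (f ` unit_disk)"
    and g: "g holomorphic_on unit_disk" "bounded (g ` unit_disk)"
    and f1: "AE \<tau> in circle_measure. ((\<lambda>r. cmod (f (of_real r * \<tau>))) \<longlongrightarrow> 1) (at_left 1)"
  shows "inner_disk f \<and> inner_disk g"
proof -
  let ?P = "\<lambda>s t l. ((\<lambda>r. f (of_real r * s) * g (of_real r * t)) \<longlongrightarrow> l) (at_left 1)"
  have "AE \<tau> in circle_measure \<Otimes>\<^sub>M circle_measure. \<exists>l. cmod l = 1 \<and>
          ((\<lambda>r. \<theta> (of_real r * fst \<tau>, of_real r * snd \<tau>)) \<longlongrightarrow> l) (at_left 1)"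
    using \<theta> by (simp add: inner_bidisk_def)
  then have "AE \<tau> in circle_measure \<Otimes>\<^sub>M circle_measure. \<exists>l. cmod l = 1 \<and> ?P (fst \<tau>) (snd \<tau>) l"
    using AE_space
  proof eventually_elim
    case (elim \<tau>)
    then have \<tau>: "cmod (fst \<tau>) = 1" "cmod (snd \<tau>) = 1"
      by (auto simp: space_pair_measure)
    have "eventually (\<lambda>r. \<theta> (of_real r * fst \<tau>, of_real r * snd \<tau>)
        = f (of_real r * fst \<tau>) * g (of_real r * snd \<tau>)) (at_left 1)"
      using eventually_at_left_1
      by eventually_elim
         (use eq \<tau> of_real_mult_in_unit_disk in \<open>auto simp: mem_bidisk simp del: mem_ball\<close>)
    with elim(1) show ?case using tendsto_cong by force
  qed
  from torus.AE_pair[OF this]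
  have prod: "AE s in circle_measure. AE t in circle_measure. \<exists>l. cmod l = 1 \<and> ?P s t l"
    by simp
  have "inner_disk g"
  proof -
    have "\<exists>s. s \<in> space circle_measure \<and>
        ((\<lambda>r. cmod (f (of_real r * s))) \<longlongrightarrow> 1) (at_left 1) \<and>
        (AE t in circle_measure. \<exists>l. cmod l = 1 \<and> ?P s t l)"
      by (intro eventually_happens'[OF circle.ae_filter_bot] eventually_conj AE_space f1 prod)
    then obtain s where s: "cmod s = 1" "((\<lambda>r. cmod (f (of_real r * s))) \<longlongrightarrow> 1) (at_left 1)"
      and ae: "AE t in circle_measure. \<exists>l. cmod l = 1 \<and> ?P s t l"
      by auto
    \<comment> \<open>With \<open>s\<close> fixed this is a weight in the radius alone, and its
      product with \<open>g (of_real r * t)\<close> converges for almost every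
      \<open>t\<close>.\<close>
    define u where "u r = f (of_real r * s)" for r
    obtain w where w: "w \<in> unit_disk" "g w \<noteq> 0"
      using inner_bidisk_not_zero[OF \<theta>] eq by (force simp: mem_bidisk)
    obtain B where B: "\<And>z. z \<in> unit_disk \<Longrightarrow> cmod (f z) \<le> B"
      using f(2) unfolding bounded_iff by blast
    have "AE t in circle_measure. \<exists>l. ((\<lambda>r. g (of_real r * t) * u r) \<longlongrightarrow> l) (at_left 1)"
      using ae by eventually_elim (auto simp: u_def mult.commute)
    then obtain l where l: "l \<in> borel_measurable circle_measure"
      and lim: "AE t in circle_measure. ((\<lambda>r. g (of_real r * t) * u r) \<longlongrightarrow> l t) (at_left 1)"
      by (rule radial_limit_measurable[OF g(1)])
    have "cmod (u r) \<le> B" if "0 < r" "r < 1" for r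
      unfolding u_def by (rule B, rule of_real_mult_in_unit_disk) (use that s in auto)
    \<comment> \<open>The weighted function therefore converges along the ray through the interior
      point \<open>w\<close> too, where \<open>g\<close> tends to \<open>g w\<close>, which is
      nonzero. Dividing shows that \<open>u\<close> itself converges.\<close>
    note radial_limit_Cauchy[OF g w(1) this l lim]
    from tendsto_divide[OF this tendsto_radial[OF g(1) w(1)] w(2)]
    obtain v where v: "((\<lambda>r. g (of_real r * w) * u r / g (of_real r * w)) \<longlongrightarrow> v) (at_left 1)"
      by blast
    have "eventually (\<lambda>r. g (of_real r * w) \<noteq> 0) (at_left 1)"
      by (rule tendsto_imp_eventually_ne[OF tendsto_radial[OF g(1) w(1)] w(2)])
    then have "eventually (\<lambda>r. g (of_real r * w) * u r / g (of_real r * w) = u r) (at_left 1)"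
      by eventually_elim simp
    with v have u: "(u \<longlongrightarrow> v) (at_left 1)"
      using tendsto_cong by force
    have v1: "cmod v = 1"
      using tendsto_unique[OF _ tendsto_norm[OF u] s(2)[folded u_def]] by simp
    have une: "eventually (\<lambda>r. u r \<noteq> 0) (at_left 1)"
      by (rule tendsto_imp_eventually_ne[OF u]) (use v1 in auto)
    have "AE t in circle_measure. \<exists>l. cmod l = 1 \<and> ((\<lambda>r. g (of_real r * t)) \<longlongrightarrow> l) (at_left 1)"
      using ae
    proof eventually_elim
      case (elim t)
      then obtain l where l: "cmod l = 1" "((\<lambda>r. u r * g (of_real r * t)) \<longlongrightarrow> l) (at_left 1)"
        by (auto simp: u_def)
      have "((\<lambda>r. u r * g (of_real r * t) / u r) \<longlongrightarrow> l / v) (at_left 1)"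
        by (rule tendsto_divide[OF l(2) u]) (use v1 in auto)
      moreover have "eventually (\<lambda>r. u r * g (of_real r * t) / u r = g (of_real r * t)) (at_left 1)"
        using une by eventually_elim simp
      ultimately have "((\<lambda>r. g (of_real r * t)) \<longlongrightarrow> l / v) (at_left 1)"
        using tendsto_cong by force
      moreover have "cmod (l / v) = 1" using l v1 by (simp add: norm_divide)
      ultimately show ?case by blast
    qed
    then show ?thesis using g by (simp add: inner_disk_def)
  qed
  moreover have "inner_disk f"
  proof -
    have aeg: "AE t in circle_measure. \<exists>v. cmod v = 1 \<and> ((\<lambda>r. g (of_real r * t)) \<longlongrightarrow> v) (at_left 1)"
      using \<open>inner_disk g\<close> by (simp add: inner_disk_def)
    have "AE s in circle_measure. \<exists>l. cmod l = 1 \<and> ((\<lambda>r. f (of_real r * s)) \<longlongrightarrow> l) (at_left 1)"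
      using prod
    proof eventually_elim
      case (elim s)
      \<comment> \<open>For each generic \<open>s\<close> a single \<open>t\<close>, which may
        depend on \<open>s\<close>, at which both the product and \<open>g\<close> have unimodular
        limits is enough to divide.\<close>
      have "\<exists>t. (\<exists>l. cmod l = 1 \<and> ?P s t l) \<and>
          (\<exists>v. cmod v = 1 \<and> ((\<lambda>r. g (of_real r * t)) \<longlongrightarrow> v) (at_left 1))"
        by (intro eventually_happens'[OF circle.ae_filter_bot] eventually_conj elim aeg)
      then obtain t l v where l: "cmod l = 1" "?P s t l" and v: "cmod v = 1"
        and gv: "((\<lambda>r. g (of_real r * t)) \<longlongrightarrow> v) (at_left 1)"
        by blast
      have v0: "v \<noteq> 0" using v by auto
      have "eventually (\<lambda>r. f (of_real r * s) * g (of_real r * t) / g (of_real r * t)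
          = f (of_real r * s)) (at_left 1)"
        using tendsto_imp_eventually_ne[OF gv v0] by eventually_elim simp
      with tendsto_divide[OF l(2) gv v0]
      have "((\<lambda>r. f (of_real r * s)) \<longlongrightarrow> l / v) (at_left 1)"
        using tendsto_cong by force
      moreover have "cmod (l / v) = 1" using l v by (simp add: norm_divide)
      ultimately show ?case by blast
    qed
    then show ?thesis using f by (simp add: inner_disk_def)
  qed
  ultimately show ?thesis by simp
qed


section \<open>From Agler kernels to a product\<close>

lemma bounded_cross_sections:
  assumes "bounded (\<theta> ` bidisk)" "w \<in> unit_disk"
  shows "bounded ((\<lambda>z. \<theta> (z, w)) ` unit_disk)" "bounded ((\<lambda>z. \<theta> (w, z)) ` unit_disk)"
  by (rule bounded_subset[OF assms(1)]; use assms(2) in \<open>auto simp: bidisk_def\<close>)+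

lemma agler_kernels_imp_product:
  assumes \<theta>: "inner_bidisk \<theta>" and K: "agler_kernels \<theta> K1 K2"
    and k: "\<forall>z\<in>bidisk. \<forall>w\<in>bidisk. K1 z w = k (snd z) (cnj (snd w))"
    and lim: "\<forall>z2\<in>unit_disk. \<forall>w2\<in>unit_disk. AE \<tau> in circle_measure.
             ((\<lambda>r. of_real (1 - r\<^sup>2 * (cmod \<tau>)\<^sup>2) *
                  K2 (of_real r * \<tau>, z2) (of_real r * \<tau>, w2)) \<longlongrightarrow> 0) (at_left 1)"
  shows "\<exists>\<phi> \<psi>. inner_disk \<phi> \<and> inner_disk \<psi> \<and> (\<forall>z\<in>bidisk. \<theta> z = \<phi> (fst z) * \<psi> (snd z))"
proof -
  \<comment> \<open>What the Agler identity leaves as the limit once its \<open>K2\<close> term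
    tends to 0.\<close>
  define L where "L z w = 1 - (1 - z * cnj w) * k z (cnj w)" for z w
  have hol: "\<theta> holomorphic2_on bidisk" and bd: "bounded (\<theta> ` bidisk)"
    using \<theta> by (auto simp: inner_bidisk_def)
  have L: "AE \<tau> in circle_measure. ((\<lambda>r. \<theta> (of_real r * \<tau>, z) * cnj (\<theta> (of_real r * \<tau>, w)))
      \<longlongrightarrow> L z w) (at_left 1)" if z: "z \<in> unit_disk" and w: "w \<in> unit_disk" for z w
    using lim[rule_format, OF z w] AE_space
  proof eventually_elim
    case (elim \<tau>)
    then have \<tau>: "cmod \<tau> = 1" by simp
    have "((\<lambda>r. L z w - of_real (1 - r\<^sup>2 * (cmod \<tau>)\<^sup>2) *
                  K2 (of_real r * \<tau>, z) (of_real r * \<tau>, w)) \<longlongrightarrow> L z w - 0) (at_left 1)"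
      by (intro tendsto_diff tendsto_const elim)
    moreover have "eventually (\<lambda>r. L z w - of_real (1 - r\<^sup>2 * (cmod \<tau>)\<^sup>2) *
                  K2 (of_real r * \<tau>, z) (of_real r * \<tau>, w)
        = \<theta> (of_real r * \<tau>, z) * cnj (\<theta> (of_real r * \<tau>, w))) (at_left 1)"
      using eventually_at_left_1
    proof eventually_elim
      case (elim r)
      have b: "(of_real r * \<tau>, z) \<in> bidisk" "(of_real r * \<tau>, w) \<in> bidisk"
        using z w elim \<tau> of_real_mult_in_unit_disk[of r \<tau>] by (auto simp: mem_bidisk simp del: mem_ball)
      have "1 - \<theta> (of_real r * \<tau>, z) * cnj (\<theta> (of_real r * \<tau>, w)) =
          of_real (1 - r\<^sup>2 * (cmod \<tau>)\<^sup>2) * K2 (of_real r * \<tau>, z) (of_real r * \<tau>, w)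
          + (1 - z * cnj w) * k z (cnj w)"
        using K b k radial_mult_cnj[of r \<tau>] unfolding agler_kernels_def by simp
      then show ?case by (simp add: L_def algebra_simps)
    qed
    ultimately show ?case
      using tendsto_cong by force
  qed
  \<comment> \<open>If the diagonal of \<open>L\<close> vanished, every slice of \<theta> in the
    first variable would have radial limits 0, and \<theta> would be zero.\<close>
  have "\<exists>w\<in>unit_disk. L w w \<noteq> 0"
  proof (rule ccontr)
    assume "\<not> ?thesis"
    then have L0: "L w w = 0" if "w \<in> unit_disk" for w using that by auto
    have "\<theta> (z, w) = 0" if z: "z \<in> unit_disk" and w: "w \<in> unit_disk" for z w
    proof (rule radial_limit_zero[OF _ _ _ z, of "\<lambda>z. \<theta> (z, w)"])
      show "AE \<tau> in circle_measure. ((\<lambda>r. \<theta> (of_real r * \<tau>, w)) \<longlongrightarrow> 0) (at_left 1)"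
        using L[OF w w]
      proof eventually_elim
        case (elim \<tau>)
        have "((\<lambda>r. sqrt (cmod (\<theta> (of_real r * \<tau>, w) * cnj (\<theta> (of_real r * \<tau>, w))))) \<longlongrightarrow>
            sqrt (cmod (L w w))) (at_left 1)"
          by (intro tendsto_intros elim)
        then show ?case
          by (simp add: L0[OF w] norm_mult tendsto_norm_zero_iff)
      qed
    qed (use holomorphic2_on_slices[OF hol w] bounded_cross_sections[OF bd w] in auto)
    then show False
      using inner_bidisk_not_zero[OF \<theta>] by (force simp: mem_bidisk)
  qed
  then obtain w0 where w0: "w0 \<in> unit_disk" "L w0 w0 \<noteq> 0" by blast
  obtain \<tau> where
    "((\<lambda>r. \<theta> (of_real r * \<tau>, w0) * cnj (\<theta> (of_real r * \<tau>, w0))) \<longlongrightarrow> L w0 w0) (at_left 1)"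
    using eventually_happens'[OF circle.ae_filter_bot L[OF w0(1) w0(1)]] by blast
  \<comment> \<open>It is a limit of squared moduli.\<close>
  then have "L w0 w0 \<in> \<real>\<^sub>\<ge>\<^sub>0"
    by (rule Lim_in_closed_set[rotated 3]) (auto simp: complex_nonneg_Reals_iff)
  then obtain R where R: "R > 0" "L w0 w0 = of_real R"
    using w0(2) by (auto simp: nonneg_Reals_def less_le)
  \<comment> \<open>Dividing the slice at \<open>w0\<close> by \<open>s\<close> makes the modulus of
    \<open>f\<close> tend to 1 radially; the second division by \<open>s\<close> goes into
    \<open>g\<close>, so that \<open>f z * g w\<close> is \<theta>(z, w0) L(w, w0) / s^2.\<close>
  define s where "s = sqrt R"
  have s: "s > 0" "L w0 w0 = of_real s * of_real s"
    using R by (auto simp: s_def simp flip: of_real_mult)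
  define f where "f z = \<theta> (z, w0) / of_real s" for z
  define g where "g z = L z w0 / of_real s" for z
  have fh: "f holomorphic_on unit_disk"
    unfolding f_def using holomorphic2_on_slices(1)[OF hol w0(1)] s(1)
    by (intro holomorphic_intros) auto
  have "bounded ((\<lambda>z. inverse s *\<^sub>R z) ` (\<lambda>z. \<theta> (z, w0)) ` unit_disk)"
    by (rule bounded_scaling[OF bounded_cross_sections(1)[OF bd w0(1)]])
  then have fb: "bounded (f ` unit_disk)"
    by (simp add: f_def image_image scaleR_conv_of_real divide_inverse mult.commute)
  have f1: "AE \<tau> in circle_measure. ((\<lambda>r. cmod (f (of_real r * \<tau>))) \<longlongrightarrow> 1) (at_left 1)"
    using L[OF w0(1) w0(1)]
  proof eventually_elim
    case (elim \<tau>)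
    have "((\<lambda>r. sqrt (cmod (\<theta> (of_real r * \<tau>, w0) * cnj (\<theta> (of_real r * \<tau>, w0)))) / s) \<longlongrightarrow>
        sqrt (cmod (L w0 w0)) / s) (at_left 1)"
      using s(1) by (intro tendsto_intros elim) auto
    then show ?case
      using s by (simp add: f_def norm_mult norm_divide)
  qed
  have eq: "\<theta> (z, w) = f z * g w" if z: "z \<in> unit_disk" and w: "w \<in> unit_disk" for z w
  proof -
    let ?h = "\<lambda>z. \<theta> (z, w) - f z * g w"
    have "?h z = 0"
    proof (rule radial_limit_zero[OF _ _ _ z, of ?h])
      show "?h holomorphic_on unit_disk"
        by (intro holomorphic_intros holomorphic2_on_slices(1)[OF hol w] fh)
      obtain A where A: "\<And>z. z \<in> unit_disk \<Longrightarrow> cmod (f z) \<le> A"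
        using fb unfolding bounded_iff by blast
      obtain B where B: "\<And>z. z \<in> unit_disk \<Longrightarrow> cmod (\<theta> (z, w)) \<le> B"
        using bounded_cross_sections(1)[OF bd w] unfolding bounded_iff by blast
      show "bounded (?h ` unit_disk)"
        unfolding bounded_iff
        by (rule exI[of _ "B + A * cmod (g w)"])
           (auto simp: norm_mult intro!: norm_triangle_le_diff add_mono mult_right_mono A B)
      show "AE \<tau> in circle_measure. ((\<lambda>r. ?h (of_real r * \<tau>)) \<longlongrightarrow> 0) (at_left 1)"
        using f1 L[OF w w0(1)] L[OF w0(1) w0(1)]
      proof eventually_elim
        case (elim \<tau>)
        let ?f = "\<lambda>r. f (of_real r * \<tau>)" and ?t = "\<lambda>r. \<theta> (of_real r * \<tau>, w)"
          and ?q = "\<lambda>r. \<theta> (of_real r * \<tau>, w0)"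
        \<comment> \<open>Only products of \<theta> with a conjugated slice are known to converge,
          so \<open>?h\<close> is first multiplied by the conjugate of \<open>f\<close>. Since |f|
          tends to 1, that factor can be removed afterwards.\<close>
        have "((\<lambda>r. (?t r * cnj (?q r) - (?q r * cnj (?q r)) * (g w / s)) / s) \<longlongrightarrow>
            (L w w0 - L w0 w0 * (g w / s)) / s) (at_left 1)"
          using s(1)
          by (intro tendsto_divide[OF tendsto_diff[OF elim(2) tendsto_mult[OF elim(3) tendsto_const]]
                tendsto_const]) auto
        also have "(L w w0 - L w0 w0 * (g w / s)) / s = 0"
          using s by (simp add: g_def)
        also have "(\<lambda>r. (?t r * cnj (?q r) - (?q r * cnj (?q r)) * (g w / s)) / s) =
            (\<lambda>r. ?h (of_real r * \<tau>) * cnj (?f r))"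
          using s(1) by (auto simp: f_def fun_eq_iff field_simps)
        finally have "((\<lambda>r. cmod (?h (of_real r * \<tau>) * cnj (?f r)) / cmod (?f r)) \<longlongrightarrow> cmod 0 / 1) (at_left 1)"
          by (intro tendsto_divide tendsto_norm elim(1)) auto
        moreover have "eventually (\<lambda>r. cmod (?h (of_real r * \<tau>) * cnj (?f r)) / cmod (?f r)
            = cmod (?h (of_real r * \<tau>))) (at_left 1)"
          using tendsto_imp_eventually_ne[OF elim(1) zero_neq_one[symmetric]]
          by eventually_elim (simp add: norm_mult)
        ultimately have "((\<lambda>r. cmod (?h (of_real r * \<tau>))) \<longlongrightarrow> 0) (at_left 1)"
          using tendsto_cong by force
        then show ?case
          by (rule tendsto_norm_zero_cancel)
      qed
    qed
    then show ?thesis by simp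
  qed
  \<comment> \<open>By its definition \<open>g\<close> comes from \<open>k\<close>, about which no
    regularity is known. Dividing the factorisation at \<open>z0\<close> shows that \<open>g\<close>
    is a multiple of a slice of \<theta>, hence holomorphic and bounded.\<close>
  obtain z0 where z0: "z0 \<in> unit_disk" "f z0 \<noteq> 0"
    using inner_bidisk_not_zero[OF \<theta>] eq by (force simp: mem_bidisk)
  have geq: "g w = inverse (f z0) * \<theta> (z0, w)" if "w \<in> unit_disk" for w
    using eq[OF z0(1) that] z0(2) by simp
  have "(\<lambda>w. inverse (f z0) * \<theta> (z0, w)) holomorphic_on unit_disk"
    by (intro holomorphic_intros holomorphic2_on_slices(2)[OF hol z0(1)])
  then have gh: "g holomorphic_on unit_disk"
    by (rule holomorphic_transform) (simp add: geq)
  obtain B where B: "\<And>w. w \<in> unit_disk \<Longrightarrow> cmod (\<theta> (z0, w)) \<le> B"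
    using bounded_cross_sections(2)[OF bd z0(1)] unfolding bounded_iff by blast
  have gb: "bounded (g ` unit_disk)"
    unfolding bounded_iff
    by (rule exI[of _ "cmod (inverse (f z0)) * B"])
       (auto simp only: ball_simps geq norm_mult intro!: mult_left_mono norm_ge_zero B)
  have eq': "\<theta> z = f (fst z) * g (snd z)" if "z \<in> bidisk" for z
    using eq[of "fst z" "snd z"] that by (simp add: mem_bidisk)
  show ?thesis
    using inner_bidisk_product_factors[OF \<theta> eq' fh fb gh gb f1] eq' by blast
qed

section \<open>From a product to Agler kernels\<close>

text \<open>The weight \<open>h\<close> is absorbed into the coefficients of the quadratic form, and
  \<open>s\<close> will be a coordinate projection; \<open>inner_disk_norm_le_1\<close> supplies the
  bound needed for Pick's theorem.\<close>

lemma Pick_kernel_positive: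
  assumes "inner_disk f"
    and "\<And>z. z \<in> S \<Longrightarrow> s z \<in> unit_disk"
  shows "positive_kernel_on S (\<lambda>z w. h z * cnj (h w) *
    ((1 - f (s z) * cnj (f (s w))) / (1 - s z * cnj (s w))))"
  unfolding positive_kernel_on_def
proof (intro allI impI)
  fix F and c :: "'a \<Rightarrow> complex" assume F: "finite F \<and> F \<subseteq> S"
  have "(\<Sum>z\<in>F. \<Sum>w\<in>F. (c z * h z) * cnj (c w * h w) *
      ((1 - f (s z) * cnj (f (s w))) / (1 - s z * cnj (s w)))) \<in> \<real>\<^sub>\<ge>\<^sub>0"
    by (rule Pick_positive)
       (use assms F inner_disk_norm_le_1[OF assms(1)] in \<open>auto simp: inner_disk_def simp del: mem_ball\<close>)
  then show "(\<Sum>z\<in>F. \<Sum>w\<in>F. c z * cnj (c w) * (h z * cnj (h w) *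
      ((1 - f (s z) * cnj (f (s w))) / (1 - s z * cnj (s w))))) \<in> \<real>\<^sub>\<ge>\<^sub>0"
    by (simp add: mult_ac)
qed

lemma product_imp_agler_kernels:
  assumes \<phi>: "inner_disk \<phi>" and \<psi>: "inner_disk \<psi>"
    and eq: "\<forall>z\<in>bidisk. \<theta> z = \<phi> (fst z) * \<psi> (snd z)"
  shows "\<exists>K1 K2. agler_kernels \<theta> K1 K2 \<and>
          (\<exists>k. \<forall>z\<in>bidisk. \<forall>w\<in>bidisk. K1 z w = k (snd z) (cnj (snd w))) \<and>
          (\<forall>z2\<in>unit_disk. \<forall>w2\<in>unit_disk. AE \<tau> in circle_measure.
             ((\<lambda>r. of_real (1 - r\<^sup>2 * (cmod \<tau>)\<^sup>2) *
                  K2 (of_real r * \<tau>, z2) (of_real r * \<tau>, w2)) \<longlongrightarrow> 0) (at_left 1))"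
proof -
  \<comment> \<open>The factor \<open>1 * cnj 1\<close> gives \<open>K1\<close> the shape of
    \<open>Pick_kernel_positive\<close> with constant weight.\<close>
  define K1 where "K1 z w = 1 * cnj 1 *
      ((1 - \<psi> (snd z) * cnj (\<psi> (snd w))) / (1 - snd z * cnj (snd w)))" for z w :: "complex \<times> complex"
  define K2 where "K2 z w = \<psi> (snd z) * cnj (\<psi> (snd w)) *
      ((1 - \<phi> (fst z) * cnj (\<phi> (fst w))) / (1 - fst z * cnj (fst w)))" for z w :: "complex \<times> complex"
  \<comment> \<open>The second argument stands for the conjugated coordinate, so
    \<open>cnj b\<close> recovers the coordinate itself.\<close>
  define k where "k a b = (1 - \<psi> a * cnj (\<psi> (cnj b))) / (1 - a * b)" for a b
  have "positive_kernel_on bidisk K1" "positive_kernel_on bidisk K2"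
    unfolding K1_def K2_def
    by (rule Pick_kernel_positive[OF \<psi>, where h="\<lambda>_. 1"] Pick_kernel_positive[OF \<phi>]; simp add: mem_bidisk)+
  moreover have "1 - \<theta> z * cnj (\<theta> w) =
      (1 - fst z * cnj (fst w)) * K2 z w + (1 - snd z * cnj (snd w)) * K1 z w"
    if "z \<in> bidisk" "w \<in> bidisk" for z w
  proof -
    have "1 - fst z * cnj (fst w) \<noteq> 0" "1 - snd z * cnj (snd w) \<noteq> 0"
      by (rule circle_kernel_nonzero; use that in \<open>simp add: mem_bidisk\<close>)+
    then have "(1 - fst z * cnj (fst w)) * K2 z w =
          \<psi> (snd z) * cnj (\<psi> (snd w)) * (1 - \<phi> (fst z) * cnj (\<phi> (fst w)))"
        "(1 - snd z * cnj (snd w)) * K1 z w = 1 - \<psi> (snd z) * cnj (\<psi> (snd w))"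
      by (simp_all add: K1_def K2_def)
    moreover have "\<theta> z = \<phi> (fst z) * \<psi> (snd z)" "\<theta> w = \<phi> (fst w) * \<psi> (snd w)"
      using eq that by blast+
    ultimately show ?thesis
      by (simp add: algebra_simps)
  qed
  ultimately have "agler_kernels \<theta> K1 K2"
    by (simp add: agler_kernels_def)
  moreover have "K1 z w = k (snd z) (cnj (snd w))" for z w
    by (simp add: K1_def k_def)
  moreover have "AE \<tau> in circle_measure. ((\<lambda>r. of_real (1 - r\<^sup>2 * (cmod \<tau>)\<^sup>2) *
      K2 (of_real r * \<tau>, z2) (of_real r * \<tau>, w2)) \<longlongrightarrow> 0) (at_left 1)" for z2 w2
  proof -
    \<comment> \<open>The scalar in the limit cancels the Szego denominator of \<open>K2\<close>.
      What remains is a fixed multiple of 1 - |\<phi>(r \<tau>)|^2, which tends to 0 because the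
      radial limits of \<phi> are unimodular.\<close>
    have "AE \<tau> in circle_measure. \<exists>l. cmod l = 1 \<and> ((\<lambda>r. \<phi> (of_real r * \<tau>)) \<longlongrightarrow> l) (at_left 1)"
      using \<phi> by (simp add: inner_disk_def)
    then show ?thesis
      using AE_space
    proof eventually_elim
      case (elim \<tau>)
      then obtain l where l: "cmod l = 1" "((\<lambda>r. \<phi> (of_real r * \<tau>)) \<longlongrightarrow> l) (at_left 1)"
        by blast
      have \<tau>: "cmod \<tau> = 1" using elim by simp
      have "((\<lambda>r. \<psi> z2 * cnj (\<psi> w2) * (1 - \<phi> (of_real r * \<tau>) * cnj (\<phi> (of_real r * \<tau>)))) \<longlongrightarrow>
          \<psi> z2 * cnj (\<psi> w2) * (1 - l * cnj l)) (at_left 1)"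
        by (intro tendsto_intros l)
      also have "\<psi> z2 * cnj (\<psi> w2) * (1 - l * cnj l) = 0"
        using l(1) complex_norm_square[of l] by simp
      finally have "((\<lambda>r. \<psi> z2 * cnj (\<psi> w2) *
          (1 - \<phi> (of_real r * \<tau>) * cnj (\<phi> (of_real r * \<tau>)))) \<longlongrightarrow> 0) (at_left 1)" .
      moreover have "eventually (\<lambda>r. \<psi> z2 * cnj (\<psi> w2) *
          (1 - \<phi> (of_real r * \<tau>) * cnj (\<phi> (of_real r * \<tau>))) = of_real (1 - r\<^sup>2 * (cmod \<tau>)\<^sup>2) *
          K2 (of_real r * \<tau>, z2) (of_real r * \<tau>, w2)) (at_left 1)"
        using eventually_at_left_1
      proof eventually_elim
        case (elim r)
        have "1 - of_real r * \<tau> * cnj (of_real r * \<tau>) = of_real (1 - r\<^sup>2 * (cmod \<tau>)\<^sup>2)"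
          by (simp add: radial_mult_cnj del: complex_cnj_mult)
        moreover have "1 - of_real r * \<tau> * cnj (of_real r * \<tau>) \<noteq> 0"
          using of_real_mult_in_unit_disk[of r \<tau>] elim \<tau> by (intro circle_kernel_nonzero) auto
        ultimately show ?case
          by (simp add: K2_def)
      qed
      ultimately show ?case
        using tendsto_cong by force
    qed
  qed
  ultimately show ?thesis by blast
qed

lemma product_iff_agler_kernels:
  assumes "inner_bidisk \<theta>"
  shows "(\<exists>\<phi> \<psi>. inner_disk \<phi> \<and> inner_disk \<psi> \<and>
          (\<forall>z\<in>bidisk. \<theta> z = \<phi> (fst z) * \<psi> (snd z)))
      \<longleftrightarrow>
      (\<exists>K1 K2. agler_kernels \<theta> K1 K2 \<and>
          (\<exists>k. \<forall>z\<in>bidisk. \<forall>w\<in>bidisk. K1 z w = k (snd z) (cnj (snd w))) \<and>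
          (\<forall>z2\<in>unit_disk. \<forall>w2\<in>unit_disk. AE \<tau> in circle_measure.
             ((\<lambda>r. of_real (1 - r\<^sup>2 * (cmod \<tau>)\<^sup>2) *
                  K2 (of_real r * \<tau>, z2) (of_real r * \<tau>, w2)) \<longlongrightarrow> 0) (at_left 1)))"
    (is "?L \<longleftrightarrow> ?R")
proof
  assume ?L
  then obtain \<phi> \<psi> where "inner_disk \<phi>" "inner_disk \<psi>"
    "\<forall>z\<in>bidisk. \<theta> z = \<phi> (fst z) * \<psi> (snd z)" by blast
  then show ?R by (rule product_imp_agler_kernels)
next
  assume ?R
  then obtain K1 K2 k where "agler_kernels \<theta> K1 K2"
    "\<forall>z\<in>bidisk. \<forall>w\<in>bidisk. K1 z w = k (snd z) (cnj (snd w))"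
    "\<forall>z2\<in>unit_disk. \<forall>w2\<in>unit_disk. AE \<tau> in circle_measure.
             ((\<lambda>r. of_real (1 - r\<^sup>2 * (cmod \<tau>)\<^sup>2) *
                  K2 (of_real r * \<tau>, z2) (of_real r * \<tau>, w2)) \<longlongrightarrow> 0) (at_left 1)"
    by blast
  then show ?L by (rule agler_kernels_imp_product[OF assms])
qed

section \<open>Exchanging the two variables\<close>

lemma swap_mem_bidisk [simp]: "prod.swap z \<in> bidisk \<longleftrightarrow> z \<in> bidisk"
  by (auto simp: mem_bidisk)

lemma inner_bidisk_swap:
  assumes \<theta>: "inner_bidisk \<theta>"
  shows "inner_bidisk (\<lambda>z. \<theta> (prod.swap z))"
proof -
  have "(\<lambda>z. \<theta> (prod.swap z)) holomorphic2_on bidisk"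
    unfolding holomorphic2_on_def
  proof
    fix z :: "complex \<times> complex" assume z: "z \<in> bidisk"
    have "\<theta> holomorphic2_on bidisk" "prod.swap z \<in> bidisk"
      using \<theta> z by (simp_all add: inner_bidisk_def)
    then obtain a b where "(\<theta> has_derivative (\<lambda>h. a * fst h + b * snd h)) (at (prod.swap z))"
      by (rule holomorphic2_on_bidiskD)
    moreover have "(prod.swap has_derivative prod.swap) (at z)"
      unfolding prod.swap_def by (auto intro!: derivative_eq_intros)
    ultimately have "((\<lambda>z. \<theta> (prod.swap z)) has_derivative
        (\<lambda>h. a * fst (prod.swap h) + b * snd (prod.swap h))) (at z)"
      by (rule has_derivative_compose[rotated])
    then have "((\<lambda>z. \<theta> (prod.swap z)) has_derivative (\<lambda>h. b * fst h + a * snd h)) (at z within bidisk)"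
      by (auto simp: add.commute intro: has_derivative_at_withinI)
    then show "\<exists>a b. ((\<lambda>z. \<theta> (prod.swap z)) has_derivative (\<lambda>h. a * fst h + b * snd h))
        (at z within bidisk)" by blast
  qed
  moreover have "bounded ((\<lambda>z. \<theta> (prod.swap z)) ` bidisk)"
  proof (rule bounded_subset[of "\<theta> ` bidisk"])
    show "bounded (\<theta> ` bidisk)" using \<theta> by (simp add: inner_bidisk_def)
    show "(\<lambda>z. \<theta> (prod.swap z)) ` bidisk \<subseteq> \<theta> ` bidisk"
      by (intro image_subsetI imageI) simp
  qed
  moreover have "AE \<tau> in circle_measure \<Otimes>\<^sub>M circle_measure. \<exists>l. cmod l = 1 \<and>
      ((\<lambda>r. \<theta> (of_real r * snd \<tau>, of_real r * fst \<tau>)) \<longlongrightarrow> l) (at_left 1)"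
  proof -
    have "AE \<tau> in circle_measure \<Otimes>\<^sub>M circle_measure. \<exists>l. cmod l = 1 \<and>
        ((\<lambda>r. \<theta> (of_real r * fst \<tau>, of_real r * snd \<tau>)) \<longlongrightarrow> l) (at_left 1)"
      using \<theta> by (simp add: inner_bidisk_def)
    \<comment> \<open>The product measure is its own image under the flip, so the statement holds
      for the image measure and can be pulled back.\<close>
    then have "AE \<tau> in distr (circle_measure \<Otimes>\<^sub>M circle_measure)
          (circle_measure \<Otimes>\<^sub>M circle_measure) (\<lambda>(x, y). (y, x)). \<exists>l. cmod l = 1 \<and>
        ((\<lambda>r. \<theta> (of_real r * fst \<tau>, of_real r * snd \<tau>)) \<longlongrightarrow> l) (at_left 1)"
      by (simp only: torus.distr_pair_swap[symmetric])
    from AE_distrD[OF measurable_pair_swap' this]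
    show ?thesis by (simp add: case_prod_beta)
  qed
  ultimately show ?thesis
    by (simp add: inner_bidisk_def)
qed

lemma positive_kernel_on_swap:
  assumes "positive_kernel_on bidisk K"
  shows "positive_kernel_on bidisk (\<lambda>z w. K (prod.swap z) (prod.swap w))"
  unfolding positive_kernel_on_def
proof (intro allI impI)
  fix F and c :: "complex \<times> complex \<Rightarrow> complex" assume F: "finite F \<and> F \<subseteq> bidisk"
  have "prod.swap ` F \<subseteq> bidisk"
    by (rule image_subsetI) (use F swap_mem_bidisk in blast)
  \<comment> \<open>As the swap is an involution, the form of \<open>K\<close> on the swapped points
    with coefficients \<open>c (prod.swap z)\<close> reindexes to the required one.\<close>
  then have "(\<Sum>z\<in>prod.swap ` F. \<Sum>w\<in>prod.swap ` F.
      c (prod.swap z) * cnj (c (prod.swap w)) * K z w) \<in> \<real>\<^sub>\<ge>\<^sub>0"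
    using assms[unfolded positive_kernel_on_def, rule_format, of "prod.swap ` F" "\<lambda>z. c (prod.swap z)"] F
    by auto
  then show "(\<Sum>z\<in>F. \<Sum>w\<in>F. c z * cnj (c w) * K (prod.swap z) (prod.swap w)) \<in> \<real>\<^sub>\<ge>\<^sub>0"
    by (simp add: sum.reindex)
qed

text \<open>The swap exchanges the two factors \<open>1 - fst z * cnj (fst w)\<close> and
  \<open>1 - snd z * cnj (snd w)\<close>, so the kernels must trade places as well.\<close>

lemma agler_kernels_swap:
  assumes "agler_kernels \<theta> K1 K2"
  shows "agler_kernels (\<lambda>z. \<theta> (prod.swap z))
    (\<lambda>z w. K2 (prod.swap z) (prod.swap w)) (\<lambda>z w. K1 (prod.swap z) (prod.swap w))"
  using assms unfolding agler_kernels_def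
  by (auto intro!: positive_kernel_on_swap simp: mem_bidisk simp del: mem_ball)

theorem theorem4p2:
  fixes \<theta> :: "complex \<times> complex \<Rightarrow> complex"
  assumes "inner_bidisk \<theta>"
  shows
    "((\<exists>\<phi> \<psi>. inner_disk \<phi> \<and> inner_disk \<psi> \<and>
          (\<forall>z\<in>bidisk. \<theta> z = \<phi> (fst z) * \<psi> (snd z)))
      \<longleftrightarrow>
      (\<exists>K1 K2. agler_kernels \<theta> K1 K2 \<and>
          (\<exists>k. \<forall>z\<in>bidisk. \<forall>w\<in>bidisk. K1 z w = k (snd z) (cnj (snd w))) \<and>
          (\<forall>z2\<in>unit_disk. \<forall>w2\<in>unit_disk. AE \<tau> in circle_measure.
             ((\<lambda>r. of_real (1 - r\<^sup>2 * (cmod \<tau>)\<^sup>2) *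
                  K2 (of_real r * \<tau>, z2) (of_real r * \<tau>, w2)) \<longlongrightarrow> 0) (at_left 1))))
     \<and>
     ((\<exists>\<phi> \<psi>. inner_disk \<phi> \<and> inner_disk \<psi> \<and>
          (\<forall>z\<in>bidisk. \<theta> z = \<phi> (fst z) * \<psi> (snd z)))
      \<longleftrightarrow>
      (\<exists>K1 K2. agler_kernels \<theta> K1 K2 \<and>
          (\<exists>k. \<forall>z\<in>bidisk. \<forall>w\<in>bidisk. K2 z w = k (fst z) (cnj (fst w))) \<and>
          (\<forall>z1\<in>unit_disk. \<forall>w1\<in>unit_disk. AE \<tau> in circle_measure.
             ((\<lambda>r. of_real (1 - r\<^sup>2 * (cmod \<tau>)\<^sup>2) *
                  K1 (z1, of_real r * \<tau>) (w1, of_real r * \<tau>)) \<longlongrightarrow> 0) (at_left 1))))"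
proof (rule conjI[OF product_iff_agler_kernels[OF assms]])
  \<comment> \<open>The second equivalence is the first one for \<theta> with its variables
    exchanged; the factors \<phi> and \<psi> then trade places.\<close>
  let ?\<theta> = "\<lambda>z. \<theta> (prod.swap z)"
  have "(\<exists>\<phi> \<psi>. inner_disk \<phi> \<and> inner_disk \<psi> \<and> (\<forall>z\<in>bidisk. \<theta> z = \<phi> (fst z) * \<psi> (snd z)))
      \<longleftrightarrow> (\<exists>\<phi> \<psi>. inner_disk \<phi> \<and> inner_disk \<psi> \<and> (\<forall>z\<in>bidisk. ?\<theta> z = \<phi> (fst z) * \<psi> (snd z)))"
    (is "?a \<longleftrightarrow> ?a'")
  proof
    assume ?a
    then obtain \<phi> \<psi> where h: "inner_disk \<phi>" "inner_disk \<psi>"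
      "\<forall>z\<in>bidisk. \<theta> z = \<phi> (fst z) * \<psi> (snd z)" by blast
    then show ?a'
      by (intro exI[of _ \<psi>] exI[of _ \<phi>]) (simp add: mult.commute)
  next
    assume ?a'
    then obtain \<phi> \<psi> where h: "inner_disk \<phi>" "inner_disk \<psi>"
      "\<forall>z\<in>bidisk. ?\<theta> z = \<phi> (fst z) * \<psi> (snd z)" by blast
    have "\<theta> z = \<psi> (fst z) * \<phi> (snd z)" if "z \<in> bidisk" for z
      using h(3)[rule_format, of "prod.swap z"] that by simp
    with h(1,2) show ?a by blast
  qed
  also have "\<dots> \<longleftrightarrow>
      (\<exists>K1 K2. agler_kernels \<theta> K1 K2 \<and>
          (\<exists>k. \<forall>z\<in>bidisk. \<forall>w\<in>bidisk. K2 z w = k (fst z) (cnj (fst w))) \<and>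
          (\<forall>z1\<in>unit_disk. \<forall>w1\<in>unit_disk. AE \<tau> in circle_measure.
             ((\<lambda>r. of_real (1 - r\<^sup>2 * (cmod \<tau>)\<^sup>2) *
                  K1 (z1, of_real r * \<tau>) (w1, of_real r * \<tau>)) \<longlongrightarrow> 0) (at_left 1)))" (is "_ \<longleftrightarrow> ?c")
    \<comment> \<open>Because the swap is an involution, the same witnesses, with kernels swapped
      and traded, serve in both directions.\<close>
    unfolding product_iff_agler_kernels[OF inner_bidisk_swap[OF assms]]
  proof (intro iffI; elim exE conjE)
    fix K1 K2 k
    assume K: "agler_kernels ?\<theta> K1 K2"
      and "\<forall>z\<in>bidisk. \<forall>w\<in>bidisk. K1 z w = k (snd z) (cnj (snd w))"
        "\<forall>z2\<in>unit_disk. \<forall>w2\<in>unit_disk. AE \<tau> in circle_measure.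
             ((\<lambda>r. of_real (1 - r\<^sup>2 * (cmod \<tau>)\<^sup>2) *
                  K2 (of_real r * \<tau>, z2) (of_real r * \<tau>, w2)) \<longlongrightarrow> 0) (at_left 1)"
    then show ?c
      using agler_kernels_swap[OF K]
      by (intro exI[of _ "\<lambda>z w. K2 (prod.swap z) (prod.swap w)"]
          exI[of _ "\<lambda>z w. K1 (prod.swap z) (prod.swap w)"] conjI exI[of _ k])
         (simp_all add: mem_bidisk del: mem_ball)
  next
    fix K1 K2 k
    assume K: "agler_kernels \<theta> K1 K2"
      and "\<forall>z\<in>bidisk. \<forall>w\<in>bidisk. K2 z w = k (fst z) (cnj (fst w))"
        "\<forall>z1\<in>unit_disk. \<forall>w1\<in>unit_disk. AE \<tau> in circle_measure.
             ((\<lambda>r. of_real (1 - r\<^sup>2 * (cmod \<tau>)\<^sup>2) *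
                  K1 (z1, of_real r * \<tau>) (w1, of_real r * \<tau>)) \<longlongrightarrow> 0) (at_left 1)"
    then show "\<exists>K1 K2. agler_kernels ?\<theta> K1 K2 \<and>
          (\<exists>k. \<forall>z\<in>bidisk. \<forall>w\<in>bidisk. K1 z w = k (snd z) (cnj (snd w))) \<and>
          (\<forall>z2\<in>unit_disk. \<forall>w2\<in>unit_disk. AE \<tau> in circle_measure.
             ((\<lambda>r. of_real (1 - r\<^sup>2 * (cmod \<tau>)\<^sup>2) *
                  K2 (of_real r * \<tau>, z2) (of_real r * \<tau>, w2)) \<longlongrightarrow> 0) (at_left 1))"
      using agler_kernels_swap[OF K]
      by (intro exI[of _ "\<lambda>z w. K2 (prod.swap z) (prod.swap w)"]
          exI[of _ "\<lambda>z w. K1 (prod.swap z) (prod.swap w)"] conjI exI[of _ k])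
         (simp_all add: mem_bidisk del: mem_ball)
  qed
  finally show "?a \<longleftrightarrow> ?c" .
qed

end
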